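(* Let $u=u_1u_2u_3\cdots=1101100110110\cdots$ be the fixed point starting with $1$ of the von Neumann substitution $\nu$: $0\mapsto 0$, $1\mapsto 110$, with positions indexed starting from $1$. Let $A=\{k\ge1:u_k=0\}=\{3,6,7,10,13,\dots\}$ and $B=\{k\ge1:u_k=1\}=\{1,2,4,5,8,9,\dots\}$. Then, with $\mathbb{N}=\{1,2,3,\dots\}$, $$A+A=\mathbb{N}\setminus\{1,2,3,4,5,7,8,11,15\},\qquad B+B=\mathbb{N}\setminus\{1\}.$$
   Context: For sets $X,Y$ of integers, $X+Y=\{x+y: x\in X, y\in Y\}$. *)

theory Defs
  imports "HOL-Library.Stream" "HOL-Library.Set_Algebras"
begin

datatype letter = L0 | L1

fun vN_subst :: "letter \<Rightarrow> letter list" where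
  "vN_subst L0 = [L0]"
| "vN_subst L1 = [L1, L1, L0]"

text \<open>The action of the substitution on infinite words. It is the concatenation of the images of
  the letters, since no letter has an empty image.\<close>

definition vN_stream :: "letter stream \<Rightarrow> letter stream" where
  "vN_stream s = flat (smap vN_subst s)"

definition vN_word :: "letter stream" where
  "vN_word = (THE s. vN_stream s = s \<and> shd s = L1)"

text \<open>Positions in \<^term>\<open>s\<close> are counted from 1, while \<^term>\<open>(!!)\<close> counts from 0.\<close>

definition positions :: "letter \<Rightarrow> letter stream \<Rightarrow> nat set" where
  "positions a s = {k. 1 \<le> k \<and> s !! (k - 1) = a}"

definition setA :: "nat set" where "setA = positions L0 vN_word"

definition setB :: "nat set" where "setB = positions L1 vN_word"

text \<open>The fixed point starting with \<^term>\<open>L1\<close> exists and is unique, so the definite description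
  above is meaningful.\<close>

lemma vN_subst_nonempty: "vN_subst a \<noteq> []"
  by (cases a) simp_all

lemma vN_stream_shift: "vN_stream (w @- s) = concat (map vN_subst w) @- vN_stream s"
  by (induction w) (simp_all add: vN_stream_def vN_subst_nonempty)

fun vN_iter :: "nat \<Rightarrow> letter list" where
  "vN_iter 0 = [L1]"
| "vN_iter (Suc n) = concat (map vN_subst (vN_iter n))"

lemma vN_iter_Suc: "vN_iter (Suc n) = vN_iter n @ vN_iter n @ [L0]"
proof (induction n)
  case 0
  then show ?case by simp
next
  case (Suc n)
  have "vN_iter (Suc (Suc n)) = concat (map vN_subst (vN_iter (Suc n)))"
    by (rule vN_iter.simps)
  also have "\<dots> = concat (map vN_subst (vN_iter n @ vN_iter n @ [L0]))"
    by (simp only: Suc.IH)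
  also have "\<dots> = vN_iter (Suc n) @ vN_iter (Suc n) @ [L0]" by simp
  finally show ?case .
qed

lemma length_vN_iter: "n < length (vN_iter n)"
  by (induction n) (simp_all add: vN_iter_Suc del: vN_iter.simps(2))

lemma vN_iter_nth_mono:
  assumes "m \<le> n" "i < length (vN_iter m)"
  shows "i < length (vN_iter n) \<and> vN_iter n ! i = vN_iter m ! i"
  using assms
proof (induction n rule: dec_induct)
  case (step n)
  then show ?case by (auto simp: vN_iter_Suc nth_append simp del: vN_iter.simps(2))
qed simp

lemma vN_iter_nth:
  assumes "i < length (vN_iter m)"
  shows "vN_iter m ! i = vN_iter i ! i"
  using vN_iter_nth_mono[of m i i] vN_iter_nth_mono[of i m i] assms length_vN_iter[of i]
  by (cases "m \<le> i") auto

lemma vN_fixed_point_prefix: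
  assumes "vN_stream s = s" "shd s = L1"
  shows "\<exists>t. s = vN_iter n @- t"
proof (induction n)
  case 0
  have "s = vN_iter 0 @- stl s" using assms(2) by (cases s) simp
  then show ?case ..
next
  case (Suc n)
  then obtain t where "s = vN_iter n @- t" ..
  then have "s = vN_iter (Suc n) @- vN_stream t"
    using assms(1) vN_stream_shift[of "vN_iter n" t] by simp
  then show ?case ..
qed

lemma vN_fixed_point_nth:
  assumes "vN_stream s = s" "shd s = L1"
  shows "s !! n = vN_iter n ! n"
proof -
  obtain t where "s = vN_iter n @- t" using vN_fixed_point_prefix[OF assms] by blast
  then show ?thesis using length_vN_iter[of n] by simp
qed

lemma stream_eqI:
  assumes "\<And>n. s !! n = t !! n"
  shows "s = t"
proof -
  have "\<forall>n. s !! n = t !! n" using assms by blast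
  then show ?thesis by (coinduction arbitrary: s t) (metis snth.simps)
qed

lemma vN_fixed_point_ex1: "\<exists>!s. vN_stream s = s \<and> shd s = L1"
proof (rule ex_ex1I)
  define s where "s = smap (\<lambda>n. vN_iter n ! n) nats"
  have s_nth: "s !! n = vN_iter n ! n" for n by (simp add: s_def)
  have "vN_stream s !! n = s !! n" for n
  proof -
    have "stake (length (vN_iter n)) s = vN_iter n"
      by (rule nth_equalityI) (simp_all add: s_nth vN_iter_nth)
    then have "s = vN_iter n @- sdrop (length (vN_iter n)) s"
      by (metis stake_sdrop)
    then have "vN_stream s = vN_iter (Suc n) @- vN_stream (sdrop (length (vN_iter n)) s)"
      by (metis vN_stream_shift vN_iter.simps(2))
    moreover have "n < length (vN_iter (Suc n))"
      using length_vN_iter[of "Suc n"] by linarith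
    ultimately have "vN_stream s !! n = vN_iter (Suc n) ! n"
      by (simp del: vN_iter.simps)
    also have "\<dots> = s !! n"
      using \<open>n < length (vN_iter (Suc n))\<close> s_nth vN_iter_nth by metis
    finally show ?thesis .
  qed
  then have "vN_stream s = s" by (metis stream_eqI)
  moreover have "shd s = L1" using s_nth[of 0] by simp
  ultimately show "\<exists>s. vN_stream s = s \<and> shd s = L1" by blast
next
  fix s t
  assume "vN_stream s = s \<and> shd s = L1" "vN_stream t = t \<and> shd t = L1"
  then have "s !! n = t !! n" for n by (metis vN_fixed_point_nth)
  then show "s = t" by (rule stream_eqI)
qed

end

theory Submission
  imports Defs
begin

text \<open>The iterates satisfy \<open>\<nu>\<^bsup>n+1\<^esup>(1) = \<nu>\<^bsup>n\<^esup>(1) \<nu>\<^bsup>n\<^esup>(1) 0\<close>, so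
  with \<open>L = 2\<^bsup>n\<^esup> - 1\<close> the word \<open>u\<close> starts with a block of length \<open>L\<close>, a copy of that block,
  and a \<open>0\<close> at position \<open>2L + 1\<close>. If \<open>X\<close> is the set of positions of a letter in the first block,
  the positions up to \<open>2L + 1\<close> contain \<open>X\<close> and \<open>X + L\<close>, so their sumset contains the
  translates of \<open>X + X\<close> by \<open>0\<close>, \<open>L\<close> and \<open>2L\<close>. Once \<open>X + X\<close> covers a long enough interval, these
  translates overlap and the covered interval doubles in length; the few sums at its upper end are
  written down explicitly.\<close>

lemma length_vN_iter_eq: "length (vN_iter n) = 2 ^ Suc n - 1"
  by (induction n) (simp_all add: vN_iter_Suc del: vN_iter.simps(2))

text \<open>Existence and uniqueness of the fixed point make the definite description usable. All
  iterates long enough to have a letter at index i agree there, so any one of them can be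
  read.\<close>

lemma vN_word_nth:
  assumes "i < 2 ^ Suc n - 1"
  shows "vN_word !! i = vN_iter n ! i"
proof -
  have "vN_stream vN_word = vN_word \<and> shd vN_word = L1"
    unfolding vN_word_def by (rule theI'[OF vN_fixed_point_ex1])
  then have "vN_word !! i = vN_iter i ! i"
    by (simp add: vN_fixed_point_nth)
  also have "\<dots> = vN_iter n ! i"
    using assms by (simp only: vN_iter_nth length_vN_iter_eq)
  finally show ?thesis .
qed

lemma positions_vN_word_shift:
  assumes "k \<in> positions a vN_word" "k \<le> 2 ^ n - 1"
  shows "k + (2 ^ n - 1) \<in> positions a vN_word"
proof (cases n)
  case 0
  then show ?thesis using assms by simp
next
  case (Suc m)
  define L where "L = length (vN_iter m)"
  have L: "2 ^ n - 1 = L" "2 ^ Suc n - 1 = 2 * L + 1" "L \<ge> 1"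
    using length_vN_iter[of m] by (simp_all add: L_def length_vN_iter_eq Suc)
  have k: "1 \<le> k" "k - 1 < L" "vN_word !! (k - 1) = a"
    using assms L by (auto simp: positions_def)
  have "vN_word !! (k + L - 1) = vN_iter n ! (k + L - 1)"
    using k L by (intro vN_word_nth) simp
  \<comment> \<open>Index k + L - 1 equals L + (k - 1), which falls in the second copy of
    \<open>vN_iter m\<close> inside \<open>vN_iter n\<close>.\<close>
  also have "\<dots> = vN_iter m ! (k - 1)"
    using k by (simp add: Suc vN_iter_Suc nth_append L_def[symmetric] del: vN_iter.simps)
  also have "\<dots> = a"
    using k vN_word_nth[of "k - 1" m] L by (simp add: Suc)
  finally show ?thesis using k L by (simp add: positions_def)
qed

text \<open>This position is the end of \<open>vN_iter (n - 1)\<close>, an appended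
  \<open>L0\<close> as soon as n is at least 2.\<close>

lemma pow2_minus_1_in_setA:
  assumes "2 \<le> n"
  shows "2 ^ n - 1 \<in> setA"
proof -
  obtain m where n: "n = Suc (Suc m)"
    using assms by (metis Suc_le_D numeral_2_eq_2 Suc_le_mono)
  define L where "L = length (vN_iter m)"
  have L: "2 ^ n - 1 = 2 * L + 1"
    using length_vN_iter[of m] by (simp add: L_def length_vN_iter_eq n)
  have "vN_word !! (2 * L) = vN_iter (Suc m) ! (2 * L)"
    using L by (intro vN_word_nth) (simp add: n)
  also have "\<dots> = L0"
    by (simp add: vN_iter_Suc nth_append L_def del: vN_iter.simps)
  finally show ?thesis using L by (simp add: setA_def positions_def)
qed

lemma setA_le_15:
  assumes "k \<le> 15"
  shows "k \<in> setA \<longleftrightarrow> k \<in> {3, 6, 7, 10, 13, 14, 15}"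
proof -
  have iter: "vN_iter 3 = [L1, L1, L0, L1, L1, L0, L0, L1, L1, L0, L1, L1, L0, L0, L0]"
    by (simp add: numeral_eq_Suc)
  have "k \<in> setA \<longleftrightarrow> 1 \<le> k \<and> vN_iter 3 ! (k - 1) = L0"
    using assms vN_word_nth[of "k - 1" 3] by (auto simp: setA_def positions_def)
  moreover have "k \<in> {0, 1, 2, 3, 4, 5, 6, 7, 8, 9, 10, 11, 12, 13, 14, 15}"
    using assms by (auto simp: numeral_eq_Suc le_Suc_eq)
  ultimately show ?thesis
    by (auto simp: iter)
qed

text \<open>The bounds on both summands keep them inside the first block, where
  \<open>positions_vN_word_shift\<close> applies, so the induction can translate them. It starts at
  n = 4, the first block length (15) at which the translated intervals leave no gap.\<close>

lemma setA_sums_up_to: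
  assumes "4 \<le> n" "16 \<le> N" "N \<le> 2 * (2 ^ n - 1)"
  shows "\<exists>a\<in>setA. \<exists>b\<in>setA. a \<le> 2 ^ n - 1 \<and> b \<le> 2 ^ n - 1 \<and> N = a + b"
  using assms
proof (induction n arbitrary: N rule: dec_induct)
  case base
  have "setA \<inter> {..15} = {3, 6, 7, 10, 13, 14, 15}"
    using setA_le_15 by auto
  moreover have "N \<in> set [16..<31]"
    using base by (simp only: set_upt) simp
  then have "N \<in> {16, 17, 18, 19, 20, 21, 22, 23, 24, 25, 26, 27, 28, 29, 30}"
    by (simp del: set_upt)
  then have "\<exists>a\<in>{3, 6, 7, 10, 13, 14, 15}. \<exists>b\<in>{3, 6, 7, 10, 13, 14, 15}. N = a + b"
    by auto
  ultimately have "\<exists>a\<in>setA \<inter> {..15}. \<exists>b\<in>setA \<inter> {..15}. N = a + b"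
    by simp
  then show ?case by auto
next
  case (step n)
  define L :: nat where "L = 2 ^ n - 1"
  have "2 ^ 4 \<le> (2 ^ n :: nat)"
    using step.hyps by (intro power_increasing) auto
  then have L: "15 \<le> L" "2 ^ Suc n - 1 = 2 * L + 1"
    by (auto simp: L_def)
  have IH: "\<exists>a\<in>setA. \<exists>b\<in>setA. a \<le> L \<and> b \<le> L \<and> M = a + b" if "16 \<le> M" "M \<le> 2 * L" for M
    using step.IH that by (simp add: L_def)
  have shift: "k + L \<in> setA" if "k \<in> setA" "k \<le> L" for k
    using that positions_vN_word_shift by (simp add: setA_def L_def)
  have L_mem: "L \<in> setA" "2 * L + 1 \<in> setA"
    using pow2_minus_1_in_setA[of n] pow2_minus_1_in_setA[of "Suc n"] step.hyps L
    by (simp_all add: L_def)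
  have "N \<le> 4 * L + 2"
    using step.prems L by simp
  \<comment> \<open>Shifting neither, one or both summands by L translates the interval from 16 to
    2L. Since L \<ge> 15, each translate starts no later than just after the previous one ends. Only
    4L + 1 and 4L + 2 remain.\<close>
  then consider "N \<le> 2 * L" | "16 + L \<le> N" "N \<le> 3 * L" | "16 + 2 * L \<le> N" "N \<le> 4 * L"
    | "N = (L + L) + (2 * L + 1)" | "N = (2 * L + 1) + (2 * L + 1)"
    using L(1) by linarith
  then have "\<exists>a\<in>setA. \<exists>b\<in>setA. a \<le> 2 * L + 1 \<and> b \<le> 2 * L + 1 \<and> N = a + b"
  proof cases
    case 1
    then obtain a b where "a \<in> setA" "b \<in> setA" "a \<le> L" "b \<le> L" "N = a + b"
      using IH[of N] step.prems(1) by auto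
    then show ?thesis
      by (intro bexI[of _ a] bexI[of _ b]) auto
  next
    case 2
    then obtain a b where "a \<in> setA" "b \<in> setA" "a \<le> L" "b \<le> L" "N - L = a + b"
      using IH[of "N - L"] by force
    with 2 shift[of a] show ?thesis
      by (intro bexI[of _ "a + L"] bexI[of _ b]) auto
  next
    case 3
    then obtain a b where "a \<in> setA" "b \<in> setA" "a \<le> L" "b \<le> L" "N - 2 * L = a + b"
      using IH[of "N - 2 * L"] by force
    with 3 shift[of a] shift[of b] show ?thesis
      by (intro bexI[of _ "a + L"] bexI[of _ "b + L"]) auto
  next
    case 4
    then show ?thesis using L_mem shift[of L]
      by (intro bexI[of _ "L + L"] bexI[of _ "2 * L + 1"]) auto
  next
    case 5
    then show ?thesis using L_mem by blast
  qed
  then show ?case by (simp only: L(2))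
qed

lemma one_in_setB: "1 \<in> setB"
  using vN_word_nth[of 0 0] by (simp add: setB_def positions_def)

text \<open>The range stops at 2^n because blocks end in zeros, so sums near twice the block length
  can be out of reach. With L = 2^n - 1, the interval from 2 to L + 1 and its translate by L are
  adjacent, and only 2L + 2 needs its own witness.\<close>

lemma setB_sums_up_to:
  assumes "1 \<le> n" "2 \<le> N" "N \<le> 2 ^ n"
  shows "\<exists>a\<in>setB. \<exists>b\<in>setB. a \<le> 2 ^ n - 1 \<and> b \<le> 2 ^ n - 1 \<and> N = a + b"
  using assms
proof (induction n arbitrary: N rule: dec_induct)
  case base
  then show ?case using one_in_setB by (intro bexI[of _ 1]) auto
next
  case (step n)
  define L :: nat where "L = 2 ^ n - 1"
  have "2 ^ 1 \<le> (2 ^ n :: nat)"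
    using step.hyps by (intro power_increasing) auto
  then have L: "1 \<le> L" "2 ^ n = L + 1" "2 ^ Suc n - 1 = 2 * L + 1"
    by (auto simp: L_def)
  have IH: "\<exists>a\<in>setB. \<exists>b\<in>setB. a \<le> L \<and> b \<le> L \<and> M = a + b" if "2 \<le> M" "M \<le> L + 1" for M
    using step.IH that L by simp
  have shift: "k + L \<in> setB" if "k \<in> setB" "k \<le> L" for k
    using that positions_vN_word_shift by (simp add: setB_def L_def)
  have "N \<le> 2 * L + 2"
    using step.prems L by simp
  then consider "N \<le> L + 1" | "2 + L \<le> N" "N \<le> 2 * L + 1" | "N = (1 + L) + (1 + L)"
    by linarith
  then have "\<exists>a\<in>setB. \<exists>b\<in>setB. a \<le> 2 * L + 1 \<and> b \<le> 2 * L + 1 \<and> N = a + b"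
  proof cases
    case 1
    then obtain a b where "a \<in> setB" "b \<in> setB" "a \<le> L" "b \<le> L" "N = a + b"
      using IH[of N] step.prems(1) by auto
    then show ?thesis
      by (intro bexI[of _ a] bexI[of _ b]) auto
  next
    case 2
    then obtain a b where "a \<in> setB" "b \<in> setB" "a \<le> L" "b \<le> L" "N - L = a + b"
      using IH[of "N - L"] by force
    with 2 shift[of a] show ?thesis
      by (intro bexI[of _ "a + L"] bexI[of _ b]) auto
  next
    case 3
    then show ?thesis using shift[OF one_in_setB] L(1)
      by (intro bexI[of _ "1 + L"]) auto
  qed
  then show ?case by (simp only: L(3))
qed

lemma setA_plus_setA_ge_16:
  assumes "16 \<le> N"
  shows "N \<in> setA + setA"
proof -
  \<comment> \<open>The choice n = N gives a block that is long enough.\<close>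
  have "N < 2 ^ N"
    by (rule less_exp)
  then have "N \<le> 2 * (2 ^ N - 1)"
    using assms by linarith
  then show ?thesis
    using setA_sums_up_to[of N N] assms by (auto simp: set_plus_def)
qed

lemma setA_plus_setA_le_15:
  assumes "N \<le> 15"
  shows "N \<in> setA + setA \<longleftrightarrow> N \<in> {6, 9, 10, 12, 13, 14}"
proof
  assume "N \<in> setA + setA"
  then obtain a b where ab: "a \<in> setA" "b \<in> setA" "N = a + b"
    by (auto simp: set_plus_def)
  then have "a \<in> {3, 6, 7, 10, 13, 14, 15}" "b \<in> {3, 6, 7, 10, 13, 14, 15}"
    using assms setA_le_15[of a] setA_le_15[of b] by auto
  then show "N \<in> {6, 9, 10, 12, 13, 14}"
    using assms ab(3) by auto
next
  have sums: "a + b \<in> setA + setA" if "a \<in> {3, 6, 7, 10}" "b \<in> {3, 6, 7}" for a b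
    using that by (intro set_plus_intro) (auto simp: setA_le_15)
  assume "N \<in> {6, 9, 10, 12, 13, 14}"
  then show "N \<in> setA + setA"
    using sums[of 3 3] sums[of 3 6] sums[of 3 7] sums[of 6 6] sums[of 6 7] sums[of 7 7] by auto
qed

theorem theorem4:
  shows "setA + setA = {1..} - {1, 2, 3, 4, 5, 7, 8, 11, 15} \<and> setB + setB = {1..} - {1}"
proof
  show "setA + setA = {1..} - {1, 2, 3, 4, 5, 7, 8, 11, 15}"
  proof (rule set_eqI)
    fix N :: nat
    show "N \<in> setA + setA \<longleftrightarrow> N \<in> {1..} - {1, 2, 3, 4, 5, 7, 8, 11, 15}"
    proof (cases "N \<le> 15")
      case True
      then have "N \<in> {0, 1, 2, 3, 4, 5, 6, 7, 8, 9, 10, 11, 12, 13, 14, 15}"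
        by (auto simp: numeral_eq_Suc le_Suc_eq)
      then show ?thesis
        unfolding setA_plus_setA_le_15[OF True] by auto
    next
      case False
      then show ?thesis using setA_plus_setA_ge_16[of N] by auto
    qed
  qed
next
  show "setB + setB = {1..} - {1}"
  proof
    \<comment> \<open>Positions start at 1, so every sum is at least 2.\<close>
    show "setB + setB \<subseteq> {1..} - {1}"
      by (auto simp: set_plus_def setB_def positions_def)
  next
    show "{1..} - {1} \<subseteq> setB + setB"
    proof
      fix N :: nat
      assume "N \<in> {1..} - {1}"
      then have "2 \<le> N" by auto
      then show "N \<in> setB + setB"
        using setB_sums_up_to[of N N] less_exp[of N] by (auto simp: set_plus_def)
    qed
  qed
qed

end
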